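(* The class of $(P_7,K_{3,3}\text{-}e)$-free bipartite graphs is factorial.
   Context: Graphs are finite, simple and undirected. A graph is $(H_1,H_2)$-free if it contains no induced subgraph isomorphic to $H_1$ or $H_2$. $P_7$ is the chordless path with 7 vertices. $K_{3,3}\text{-}e$ is the graph obtained from the complete bipartite graph $K_{3,3}$ by deleting one edge. A hereditary class (one closed under taking induced subgraphs) is factorial if the number of labelled graphs in it with vertex set $\{1,\ldots,n\}$ is $2^{\Theta(n\log n)}$. *)

theory Defs
  imports Complex_Main "HOL-Library.Landau_Symbols"
begin

record 'a graph =
  verts :: "'a set"
  edges :: "'a set set"

definition simple_graph :: "'a graph \<Rightarrow> bool" where
  "simple_graph G \<longleftrightarrow>
     finite (verts G) \<and> (\<forall>e\<in>edges G. e \<subseteq> verts G \<and> card e = 2)"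

definition induced_subgraph :: "'a graph \<Rightarrow> 'a set \<Rightarrow> 'a graph" where
  "induced_subgraph G S = \<lparr>verts = S, edges = {e \<in> edges G. e \<subseteq> S}\<rparr>"

definition isomorphic :: "'a graph \<Rightarrow> 'b graph \<Rightarrow> bool" where
  "isomorphic G H \<longleftrightarrow>
     (\<exists>f. bij_betw f (verts G) (verts H) \<and>
          (\<forall>u\<in>verts G. \<forall>v\<in>verts G. {u, v} \<in> edges G \<longleftrightarrow> {f u, f v} \<in> edges H))"

definition induced_free :: "'b graph \<Rightarrow> 'a graph \<Rightarrow> bool" where
  "induced_free H G \<longleftrightarrow>
     \<not> (\<exists>S\<subseteq>verts G. isomorphic H (induced_subgraph G S))"

text \<open>The two parts may be empty, so edgeless graphs (including the empty one) are bipartite.\<close>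

definition bipartite :: "'a graph \<Rightarrow> bool" where
  "bipartite G \<longleftrightarrow>
     (\<exists>A B. A \<union> B = verts G \<and> A \<inter> B = {} \<and>
            (\<forall>e\<in>edges G. \<not> e \<subseteq> A \<and> \<not> e \<subseteq> B))"

text \<open>The parameter counts vertices, not edges.\<close>

definition path_graph :: "nat \<Rightarrow> nat graph" where
  "path_graph n = \<lparr>verts = {..<n}, edges = {{i, Suc i} | i. Suc i < n}\<rparr>"

definition complete_bipartite :: "nat \<Rightarrow> nat \<Rightarrow> (nat + nat) graph" where
  "complete_bipartite m n =
     \<lparr>verts = {..<m} <+> {..<n}, edges = {{Inl i, Inr j} | i j. i < m \<and> j < n}\<rparr>"

definition delete_edge :: "'a graph \<Rightarrow> 'a set \<Rightarrow> 'a graph" where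
  "delete_edge G e = \<lparr>verts = verts G, edges = edges G - {e}\<rparr>"

text \<open>The automorphism group of a complete bipartite graph acts transitively on its
  edges, so the choice of the deleted edge is immaterial.\<close>

definition K33_minus_edge :: "(nat + nat) graph" where
  "K33_minus_edge = delete_edge (complete_bipartite 3 3) {Inl 0, Inr 0}"

text \<open>Every finite graph has an isomorphic copy with vertices in \<^typ>\<open>nat\<close>; a class of
  graphs is represented by the set of its members with vertices in \<^typ>\<open>nat\<close>. As usual,
  a class of graphs is understood to be closed under isomorphism.\<close>

definition graph_class :: "nat graph set \<Rightarrow> bool" where
  "graph_class X \<longleftrightarrow>
     (\<forall>G\<in>X. simple_graph G) \<and>
     (\<forall>G\<in>X. \<forall>H. simple_graph H \<and> isomorphic G H \<longrightarrow> H \<in> X)"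

definition hereditary :: "nat graph set \<Rightarrow> bool" where
  "hereditary X \<longleftrightarrow>
     graph_class X \<and> (\<forall>G\<in>X. \<forall>S\<subseteq>verts G. induced_subgraph G S \<in> X)"

text \<open>Labelled graphs are counted up to equality, not up to isomorphism.\<close>

definition labelled_graphs :: "nat graph set \<Rightarrow> nat \<Rightarrow> nat graph set" where
  "labelled_graphs X n = {G \<in> X. verts G = {1..n}}"

definition factorial_class :: "nat graph set \<Rightarrow> bool" where
  "factorial_class X \<longleftrightarrow>
     hereditary X \<and>
     (\<exists>f :: nat \<Rightarrow> real.
        f \<in> \<Theta>(\<lambda>n. real n * log 2 (real n)) \<and>
        (\<forall>n. real (card (labelled_graphs X n)) = 2 powr f n))"

end

theory Submission imports Defs "HOL-Library.FuncSet"
begin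

text \<open>Write a bipartite graph as a relation \<^term>\<open>E :: ('a \<times> 'b) set\<close> between its two sides. Forbidding
  \<open>K\<^sub>3\<^sub>,\<^sub>3 - e\<close> makes the maximal bicliques \<open>(X, Y)\<close> with at least two vertices on each side (the
  blocks) behave like the lines of a partial linear space: a vertex outside \<open>X\<close> has at most
  one neighbour in \<open>Y\<close> (\<open>block_outside\<close>), two blocks share at most one vertex on each side
  (\<open>block_eq_if_two_left\<close>), and two vertices with at least two common neighbours lie in a block.

  The second ingredient is a sparsity principle, \<open>card_le_if_small_codegrees\<close>: in a bipartite
  graph with large minimum degree and bounded codegrees an induced path can be extended greedily,
  so a graph with bounded codegrees and no induced \<open>P\<^sub>7\<close> has only linearly many edges.

  Call a block rich if both of its sides have at least three vertices. The sparsity principle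
  is used twice. First, the incidence graph between the left vertices and the rich blocks has
  codegrees at most one, and an induced \<open>P\<^sub>7\<close> in it lifts to one in \<open>E\<close>
  (\<open>P7_from_blocks\<close>), because each block has three candidates for a connecting vertex and each of
  the two path vertices to be avoided excludes at most one of them. Doing the same on the right
  bounds the number of rich blocks by the number \<open>n\<close> of vertices, and their total size by \<open>6n\<close>.
  Second, consider the edges in no rich block. Two vertices have at most two
  common neighbours along such edges, unless they form one side of a block \<open>K\<^sub>2\<^sub>,\<^sub>m\<close> with
  \<open>m \<ge> 3\<close> (a heavy pair). A path of three heavy pairs would again lift to an induced \<open>P\<^sub>7\<close>,
  so the graph of heavy pairs is 3-colourable. Cutting both sides into colour classes gives nine
  pieces with bounded codegrees, hence at most \<open>12n\<close> edges in no rich block.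

  Therefore \<open>E\<close> is determined by a relation with at most \<open>18n\<close> pairs on \<open>2n\<close> points (the vertices,
  and names for the rich blocks), and there are only \<open>n\<^bsup>O(n)\<^esup>\<close> of those. Conversely the class
  contains all star forests, of which there are \<open>n\<^bsup>\<Omega>(n)\<^esup>\<close>.\<close>

section \<open>Sparse bipartite graphs without an induced path on seven vertices\<close>

text \<open>Only paths with both ends on the left are excluded; the other ones are excluded by the same
  condition on the converse relation. Distinctness of the seven vertices follows from the
  adjacencies.\<close>

definition no_P7 :: "('a \<times> 'b) set \<Rightarrow> bool" where
  "no_P7 E \<longleftrightarrow> \<not> (\<exists>a1 a2 a3 a4 b1 b2 b3.
     {(a1, b1), (a2, b1), (a2, b2), (a3, b2), (a3, b3), (a4, b3)} \<subseteq> E \<and>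
     {(a1, b2), (a1, b3), (a2, b3), (a3, b1), (a4, b1), (a4, b2)} \<inter> E = {})"

lemma no_P7D:
  assumes "no_P7 E"
    and "{(a1, b1), (a2, b1), (a2, b2), (a3, b2), (a3, b3), (a4, b3)} \<subseteq> E"
    and "{(a1, b2), (a1, b3), (a2, b3), (a3, b1), (a4, b1), (a4, b2)} \<inter> E = {}"
  shows False
  using assms(1) unfolding no_P7_def
  by (rule notE) (intro exI conjI, rule assms(2), rule assms(3))

text \<open>Remove vertices of degree at most \<open>d\<close> one by one: each removal destroys at most \<open>d\<close> edges.\<close>

lemma card_le_if_degenerate:
  fixes F :: "('a \<times> 'b) set"
  assumes "finite A" "finite B"
    and deg: "\<And>A' B'. \<lbrakk>A' \<subseteq> A; B' \<subseteq> B; A' \<noteq> {}; B' \<noteq> {}\<rbrakk> \<Longrightarrow>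
      (\<exists>a\<in>A'. card {b\<in>B'. (a, b) \<in> F} \<le> d) \<or> (\<exists>b\<in>B'. card {a\<in>A'. (a, b) \<in> F} \<le> d)"
  shows "card (F \<inter> A \<times> B) \<le> d * (card A + card B)"
  using assms
proof (induction "card A + card B" arbitrary: A B)
  case 0
  then show ?case by simp
next
  case (Suc m)
  show ?case
  proof (cases "A = {} \<or> B = {}")
    case True
    then show ?thesis by auto
  next
    case False
    then consider (left) a where "a \<in> A" "card {b\<in>B. (a, b) \<in> F} \<le> d"
      | (right) b where "b \<in> B" "card {a\<in>A. (a, b) \<in> F} \<le> d"
      using Suc.prems(3)[of A B] by blast
    then show ?thesis
    proof cases
      case left
      have cA: "card A = Suc (card (A - {a}))"
        using left(1) Suc.prems(1) by (metis card_Suc_Diff1)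
      have "card (F \<inter> (A - {a}) \<times> B) \<le> d * (card (A - {a}) + card B)"
      proof (rule Suc.hyps(1))
        show "m = card (A - {a}) + card B" using cA Suc.hyps(2) by simp
        fix A' B' assume "A' \<subseteq> A - {a}" "B' \<subseteq> B" "A' \<noteq> {}" "B' \<noteq> {}"
        then show "(\<exists>a\<in>A'. card {b\<in>B'. (a, b) \<in> F} \<le> d) \<or>
            (\<exists>b\<in>B'. card {a\<in>A'. (a, b) \<in> F} \<le> d)"
          using Suc.prems(3)[of A' B'] by blast
      qed (use Suc.prems in auto)
      moreover have "card ({a} \<times> {b\<in>B. (a, b) \<in> F}) \<le> d"
        using left(2) by (simp add: card_cartesian_product)
      moreover have split: "F \<inter> A \<times> B = F \<inter> (A - {a}) \<times> B \<union> {a} \<times> {b\<in>B. (a, b) \<in> F}"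
        using left(1) by auto
      have "card (F \<inter> A \<times> B) \<le>
          card (F \<inter> (A - {a}) \<times> B) + card ({a} \<times> {b\<in>B. (a, b) \<in> F})"
        by (subst split) (rule card_Un_le)
      ultimately show ?thesis using cA by simp
    next
      case right
      have cB: "card B = Suc (card (B - {b}))"
        using right(1) Suc.prems(2) by (metis card_Suc_Diff1)
      have "card (F \<inter> A \<times> (B - {b})) \<le> d * (card A + card (B - {b}))"
      proof (rule Suc.hyps(1))
        show "m = card A + card (B - {b})" using cB Suc.hyps(2) by simp
        fix A' B' assume "A' \<subseteq> A" "B' \<subseteq> B - {b}" "A' \<noteq> {}" "B' \<noteq> {}"
        then show "(\<exists>a\<in>A'. card {b\<in>B'. (a, b) \<in> F} \<le> d) \<or>
            (\<exists>b\<in>B'. card {a\<in>A'. (a, b) \<in> F} \<le> d)"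
          using Suc.prems(3)[of A' B'] by blast
      qed (use Suc.prems in auto)
      moreover have "card ({a\<in>A. (a, b) \<in> F} \<times> {b}) \<le> d"
        using right(2) by (simp add: card_cartesian_product)
      moreover have split: "F \<inter> A \<times> B = F \<inter> A \<times> (B - {b}) \<union> {a\<in>A. (a, b) \<in> F} \<times> {b}"
        using right(1) by auto
      have "card (F \<inter> A \<times> B) \<le>
          card (F \<inter> A \<times> (B - {b})) + card ({a\<in>A. (a, b) \<in> F} \<times> {b})"
        by (subst split) (rule card_Un_le)
      ultimately show ?thesis using cB by simp
    qed
  qed
qed

lemma ex_avoiding_two:
  assumes "2 * D < card S" "card {x\<in>S. P x} \<le> D" "card {x\<in>S. Q x} \<le> D"
  obtains x where "x \<in> S" "\<not> P x" "\<not> Q x"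
proof -
  have "finite S" using assms(1) by (metis card.infinite not_less_zero)
  have "\<not> S \<subseteq> {x\<in>S. P x} \<union> {x\<in>S. Q x}"
  proof
    assume "S \<subseteq> {x\<in>S. P x} \<union> {x\<in>S. Q x}"
    then have "card S \<le> card ({x\<in>S. P x} \<union> {x\<in>S. Q x})"
      using \<open>finite S\<close> by (intro card_mono) auto
    also have "\<dots> \<le> card {x\<in>S. P x} + card {x\<in>S. Q x}" by (rule card_Un_le)
    finally show False using assms by simp
  qed
  then show ?thesis using that by blast
qed

text \<open>If the bound failed, some nonempty part would have all \<open>F\<close>-degrees above \<open>2D\<close>. An induced path
  can then be grown along \<open>F\<close>: the next vertex must avoid at most two earlier vertices besides
  the last one, and each of them rules out at most \<open>D\<close> candidates. Having two relations matters
  because the path has to be induced in all of \<open>E\<close>, while only \<open>F\<close> is claimed to be sparse.\<close>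

lemma card_le_if_small_codegrees:
  fixes E F :: "('a \<times> 'b) set"
  assumes fin: "finite A" "finite B" and "F \<subseteq> E" and P7: "no_P7 E" and "1 \<le> D"
    and left: "\<And>a a'. \<lbrakk>a \<in> A; a' \<in> A; a \<noteq> a'\<rbrakk> \<Longrightarrow> card {b\<in>B. (a, b) \<in> F \<and> (a', b) \<in> E} \<le> D"
    and right: "\<And>b b'. \<lbrakk>b \<in> B; b' \<in> B; b \<noteq> b'\<rbrakk> \<Longrightarrow> card {a\<in>A. (a, b) \<in> F \<and> (a, b') \<in> E} \<le> D"
  shows "card (F \<inter> A \<times> B) \<le> 2 * D * (card A + card B)"
proof (rule card_le_if_degenerate[OF fin], rule ccontr)
  fix A' B'
  assume sub: "A' \<subseteq> A" "B' \<subseteq> B" and ne: "A' \<noteq> {}" "B' \<noteq> {}"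
    and "\<not> ((\<exists>a\<in>A'. card {b\<in>B'. (a, b) \<in> F} \<le> 2 * D) \<or>
      (\<exists>b\<in>B'. card {a\<in>A'. (a, b) \<in> F} \<le> 2 * D))"
  then have degA: "\<And>a. a \<in> A' \<Longrightarrow> 2 * D < card {b\<in>B'. (a, b) \<in> F}"
    and degB: "\<And>b. b \<in> B' \<Longrightarrow> 2 * D < card {a\<in>A'. (a, b) \<in> F}"
    by (meson not_le)+
  have left': "card {b\<in>{b\<in>B'. (a, b) \<in> F}. (a', b) \<in> E} \<le> D"
    if "a \<in> A'" "a' \<in> A'" "a \<noteq> a'" for a a'
  proof -
    have "card {b\<in>{b\<in>B'. (a, b) \<in> F}. (a', b) \<in> E} \<le> card {b\<in>B. (a, b) \<in> F \<and> (a', b) \<in> E}"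
      using sub fin by (intro card_mono) auto
    then show ?thesis using left[of a a'] that sub by fastforce
  qed
  have right': "card {a\<in>{a\<in>A'. (a, b) \<in> F}. (a, b') \<in> E} \<le> D"
    if "b \<in> B'" "b' \<in> B'" "b \<noteq> b'" for b b'
  proof -
    have "card {a\<in>{a\<in>A'. (a, b) \<in> F}. (a, b') \<in> E} \<le> card {a\<in>A. (a, b) \<in> F \<and> (a, b') \<in> E}"
      using sub fin by (intro card_mono) auto
    then show ?thesis using right[of b b'] that sub by fastforce
  qed
  \<comment> \<open>From \<open>b2\<close> on, every earlier vertex on the same side is adjacent to some vertex to which the
    new one must not be adjacent, so distinctness rules out no further candidates.\<close>
  obtain b1 where b1: "b1 \<in> B'" using ne by auto
  have "2 \<le> card {a\<in>A'. (a, b1) \<in> F}" using degB[OF b1] \<open>1 \<le> D\<close> by simp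
  then obtain a1 a2 where a12: "a1 \<in> A'" "a2 \<in> A'" "a1 \<noteq> a2" "(a1, b1) \<in> F" "(a2, b1) \<in> F"
    by (auto simp: numeral_2_eq_2 card_le_Suc_iff)
  obtain b2 where b2: "b2 \<in> B'" "(a2, b2) \<in> F" "(a1, b2) \<notin> E"
    using ex_avoiding_two[OF degA[of a2] left'[of a2 a1] left'[of a2 a1]] a12 by auto
  have "b1 \<noteq> b2" using a12 b2 \<open>F \<subseteq> E\<close> by auto
  obtain a3 where a3: "a3 \<in> A'" "(a3, b2) \<in> F" "(a3, b1) \<notin> E"
    using ex_avoiding_two[OF degB[of b2] right'[of b2 b1] right'[of b2 b1]] b1 b2 \<open>b1 \<noteq> b2\<close> by auto
  have "a3 \<noteq> a1" "a3 \<noteq> a2" using a3 a12 b2 \<open>F \<subseteq> E\<close> by auto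
  then obtain b3 where b3: "b3 \<in> B'" "(a3, b3) \<in> F" "(a1, b3) \<notin> E" "(a2, b3) \<notin> E"
    using ex_avoiding_two[OF degA[of a3] left'[of a3 a1] left'[of a3 a2]] a12 a3 by auto
  have "b3 \<noteq> b1" "b3 \<noteq> b2" using b3 a12 b2 \<open>F \<subseteq> E\<close> by auto
  then obtain a4 where a4: "a4 \<in> A'" "(a4, b3) \<in> F" "(a4, b1) \<notin> E" "(a4, b2) \<notin> E"
    using ex_avoiding_two[OF degB[of b3] right'[of b3 b1] right'[of b3 b2]] b1 b2 b3 by auto
  have "{(a1, b1), (a2, b1), (a2, b2), (a3, b2), (a3, b3), (a4, b3)} \<subseteq> E"
    using a12 b2 a3 b3 a4 \<open>F \<subseteq> E\<close> by auto
  moreover have "{(a1, b2), (a1, b3), (a2, b3), (a3, b1), (a4, b1), (a4, b2)} \<inter> E = {}"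
    using b2 a3 b3 a4 by auto
  ultimately show False by (rule no_P7D[OF P7])
qed

section \<open>Maximal bicliques\<close>

definition no_K33_minus_edge :: "('a \<times> 'b) set \<Rightarrow> bool" where
  "no_K33_minus_edge E \<longleftrightarrow> (\<forall>a0 a1 a2 b0 b1 b2.
     distinct [a0, a1, a2] \<and> distinct [b0, b1, b2] \<and>
     {(a0, b1), (a0, b2), (a1, b0), (a1, b1), (a1, b2), (a2, b0), (a2, b1), (a2, b2)} \<subseteq> E
     \<longrightarrow> (a0, b0) \<in> E)"

definition common :: "('a \<times> 'b) set \<Rightarrow> 'a set \<Rightarrow> 'b set" where
  "common E X = {b. \<forall>a\<in>X. (a, b) \<in> E}"

text \<open>The two closure conditions say that \<open>(X, Y)\<close> is a maximal biclique.\<close>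

definition block :: "('a \<times> 'b) set \<Rightarrow> 'a set \<Rightarrow> 'b set \<Rightarrow> bool" where
  "block E X Y \<longleftrightarrow>
     2 \<le> card X \<and> 2 \<le> card Y \<and> common E X = Y \<and> common (E\<inverse>) Y = X"

definition rich_blocks :: "('a \<times> 'b) set \<Rightarrow> ('a set \<times> 'b set) set" where
  "rich_blocks E = {(X, Y). block E X Y \<and> 3 \<le> card X \<and> 3 \<le> card Y}"

lemma no_K33_minus_edge_converse: "no_K33_minus_edge (E\<inverse>) \<longleftrightarrow> no_K33_minus_edge E"
proof -
  have "no_K33_minus_edge (E\<inverse>)" if "no_K33_minus_edge E" for E :: "('x \<times> 'y) set"
    unfolding no_K33_minus_edge_def
  proof (intro allI impI, elim conjE)
    fix a0 a1 a2 b0 b1 b2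
    assume "distinct [a0, a1, a2]" "distinct [b0, b1, b2]"
      "{(a0, b1), (a0, b2), (a1, b0), (a1, b1), (a1, b2), (a2, b0), (a2, b1), (a2, b2)} \<subseteq> E\<inverse>"
    then have "(b0, a0) \<in> E"
      using that[unfolded no_K33_minus_edge_def, rule_format, of b0 b1 b2 a0 a1 a2] by simp
    then show "(a0, b0) \<in> E\<inverse>" by simp
  qed
  from this[of E] this[of "E\<inverse>"] show ?thesis by auto
qed

lemma block_converse: "block (E\<inverse>) Y X \<longleftrightarrow> block E X Y"
  by (auto simp: block_def)

lemma rich_blocks_converse: "rich_blocks (E\<inverse>) = prod.swap ` rich_blocks E"
  by (auto simp: rich_blocks_def block_converse image_iff)

lemma block_edge: "\<lbrakk>block E X Y; a \<in> X; b \<in> Y\<rbrakk> \<Longrightarrow> (a, b) \<in> E"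
  by (auto simp: block_def common_def)

text \<open>By maximality \<open>a\<close> misses some \<open>z \<in> Y\<close>. With two neighbours \<open>y, y'\<close> in \<open>Y\<close>, the vertices
  \<open>a\<close> and two elements of \<open>X\<close> against \<open>z, y, y'\<close> would form a \<open>K\<^sub>3\<^sub>,\<^sub>3\<close> without the edge \<open>az\<close>.\<close>

lemma block_outside:
  assumes K: "no_K33_minus_edge E" and "block E X Y" "a \<notin> X"
    and "y \<in> Y" "y' \<in> Y" "(a, y) \<in> E" "(a, y') \<in> E"
  shows "y = y'"
proof (rule ccontr)
  assume "y \<noteq> y'"
  obtain z where z: "z \<in> Y" "(a, z) \<notin> E"
    using assms(2,3) by (auto simp: block_def common_def)
  have "2 \<le> card X" using assms(2) by (simp add: block_def)
  then obtain x x' where x: "x \<in> X" "x' \<in> X" "x \<noteq> x'"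
    by (auto simp: numeral_2_eq_2 card_le_Suc_iff)
  have "distinct [a, x, x']" "distinct [z, y, y']"
    using x z assms \<open>y \<noteq> y'\<close> by auto
  moreover have "{(a, y), (a, y'), (x, z), (x, y), (x, y'), (x', z), (x', y), (x', y')} \<subseteq> E"
    using x z assms block_edge[OF assms(2)] by auto
  ultimately have "(a, z) \<in> E"
    by (intro K[unfolded no_K33_minus_edge_def, rule_format]) (intro conjI)
  with z show False by simp
qed

lemma block_outside_right:
  assumes "no_K33_minus_edge E" "block E X Y" "b \<notin> Y" "x \<in> X" "x' \<in> X" "(x, b) \<in> E" "(x', b) \<in> E"
  shows "x = x'"
  using block_outside[of "E\<inverse>" Y X b x x'] assms
  by (simp add: no_K33_minus_edge_converse block_converse)

text \<open>A vertex of \<open>Y'\<close> sees the two shared vertices of \<open>X\<close>, so it cannot lie outside \<open>Y\<close>.\<close>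

lemma block_eq_if_two_left:
  assumes K: "no_K33_minus_edge E" and b: "block E X Y" and b': "block E X' Y'"
    and "x \<in> X \<inter> X'" "x' \<in> X \<inter> X'" "x \<noteq> x'"
  shows "X = X' \<and> Y = Y'"
proof -
  have "Y' \<subseteq> Y"
    using block_outside_right[OF K b] block_edge[OF b'] assms by blast
  moreover have "Y \<subseteq> Y'"
    using block_outside_right[OF K b'] block_edge[OF b] assms by blast
  ultimately have "Y = Y'" by simp
  then show ?thesis using b b' by (auto simp: block_def)
qed

lemma block_avoid_two:
  assumes "no_K33_minus_edge E" "block E X Y" "3 \<le> card Y" "a \<notin> X" "a' \<notin> X"
  obtains y where "y \<in> Y" "(a, y) \<notin> E" "(a', y) \<notin> E"
proof (rule ex_avoiding_two[of 1 Y "\<lambda>y. (a, y) \<in> E" "\<lambda>y. (a', y) \<in> E"])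
  have "finite Y" using assms(3) card.infinite by fastforce
  then show "card {y\<in>Y. (a, y) \<in> E} \<le> 1" "card {y\<in>Y. (a', y) \<in> E} \<le> 1"
    using block_outside[OF assms(1,2)] assms(4,5) by (auto simp: card_le_Suc0_iff_eq)
qed (use assms that in auto)

text \<open>An induced path \<open>a1, X1, a2, X2, a3, X3, a4\<close> of vertices and blocks lifts to an induced path of
  \<open>E\<close> by picking in each \<open>Yi\<close> a connecting vertex that is not adjacent to the two \<open>aj\<close> outside
  \<open>Xi\<close>.\<close>

lemma P7_from_blocks:
  assumes K: "no_K33_minus_edge E"
    and blocks: "block E X1 Y1" "block E X2 Y2" "block E X3 Y3"
    and Y: "3 \<le> card Y1" "3 \<le> card Y2" "3 \<le> card Y3"
    and a: "a1 \<in> X1" "a2 \<in> X1" "a2 \<in> X2" "a3 \<in> X2" "a3 \<in> X3" "a4 \<in> X3"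
      "a3 \<notin> X1" "a4 \<notin> X1" "a1 \<notin> X2" "a4 \<notin> X2" "a1 \<notin> X3" "a2 \<notin> X3"
  shows "\<not> no_P7 E"
proof -
  obtain y1 where y1: "y1 \<in> Y1" "(a3, y1) \<notin> E" "(a4, y1) \<notin> E"
    using block_avoid_two[OF K blocks(1) Y(1)] a by metis
  obtain y2 where y2: "y2 \<in> Y2" "(a1, y2) \<notin> E" "(a4, y2) \<notin> E"
    using block_avoid_two[OF K blocks(2) Y(2)] a by metis
  obtain y3 where y3: "y3 \<in> Y3" "(a1, y3) \<notin> E" "(a2, y3) \<notin> E"
    using block_avoid_two[OF K blocks(3) Y(3)] a by metis
  have "{(a1, y1), (a2, y1), (a2, y2), (a3, y2), (a3, y3), (a4, y3)} \<subseteq> E"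
    using y1 y2 y3 a blocks block_edge by fast
  moreover have "{(a1, y2), (a1, y3), (a2, y3), (a3, y1), (a4, y1), (a4, y2)} \<inter> E = {}"
    using y1 y2 y3 by auto
  ultimately show ?thesis using no_P7D by metis
qed

lemma rich_block_subset:
  assumes "E \<subseteq> A \<times> B" "(X, Y) \<in> rich_blocks E"
  shows "X \<subseteq> A" "Y \<subseteq> B"
proof -
  have "block E X Y" "X \<noteq> {}" "Y \<noteq> {}" using assms(2) by (auto simp: rich_blocks_def)
  then show "X \<subseteq> A" "Y \<subseteq> B" using block_edge assms(1) by fast+
qed

lemma finite_rich_blocks:
  assumes "finite A" "finite B" "E \<subseteq> A \<times> B"
  shows "finite (rich_blocks E)"
proof (rule finite_subset)
  show "rich_blocks E \<subseteq> Pow A \<times> Pow B"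
    using rich_block_subset[OF assms(3)] by fast
qed (use assms in simp)

text \<open>The left-hand side counts the edges of the incidence graph \<open>J\<close> between left vertices and rich
  blocks, so this is the sparsity bound with codegree one for \<open>J\<close>.\<close>

lemma sum_left_sides:
  fixes E :: "('a \<times> 'b) set"
  assumes fin: "finite A" "finite B" and E: "E \<subseteq> A \<times> B"
    and P7: "no_P7 E" and K: "no_K33_minus_edge E"
  shows "(\<Sum>\<beta>\<in>rich_blocks E. card (fst \<beta>)) \<le> 2 * (card A + card (rich_blocks E))"
proof -
  let ?R = "rich_blocks E"
  define J where "J = {(a, \<beta>). \<beta> \<in> ?R \<and> a \<in> fst \<beta>}"
  have finR: "finite ?R" using finite_rich_blocks[OF fin E] .
  have eq: "\<beta> = \<gamma>" if "\<beta> \<in> ?R" "\<gamma> \<in> ?R" "a \<in> fst \<beta> \<inter> fst \<gamma>" "a' \<in> fst \<beta> \<inter> fst \<gamma>" "a \<noteq> a'"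
    for \<beta> \<gamma> a a'
  proof -
    have "block E (fst \<beta>) (snd \<beta>)" "block E (fst \<gamma>) (snd \<gamma>)"
      using that(1,2) by (auto simp: rich_blocks_def)
    from block_eq_if_two_left[OF K this that(3,4,5)] show ?thesis by (simp add: prod_eq_iff)
  qed
  have "card (J \<inter> A \<times> ?R) \<le> 2 * 1 * (card A + card ?R)"
  proof (rule card_le_if_small_codegrees[OF fin(1) finR order_refl])
    show "no_P7 J"
      unfolding no_P7_def
    proof (intro notI, elim exE conjE)
      fix a1 a2 a3 a4 \<beta>1 \<beta>2 \<beta>3
      assume in_J: "{(a1, \<beta>1), (a2, \<beta>1), (a2, \<beta>2), (a3, \<beta>2), (a3, \<beta>3), (a4, \<beta>3)} \<subseteq> J"
        and notin_J: "{(a1, \<beta>2), (a1, \<beta>3), (a2, \<beta>3), (a3, \<beta>1), (a4, \<beta>1), (a4, \<beta>2)} \<inter> J = {}"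
      obtain X1 Y1 X2 Y2 X3 Y3 where "\<beta>1 = (X1, Y1)" "\<beta>2 = (X2, Y2)" "\<beta>3 = (X3, Y3)"
        by (metis surj_pair)
      with in_J notin_J have "\<not> no_P7 E"
        by (intro P7_from_blocks[OF K, of X1 Y1 X2 Y2 X3 Y3 a1 a2 a3 a4])
           (auto simp: J_def rich_blocks_def)
      with P7 show False by simp
    qed
    show "card {\<beta>\<in>?R. (a, \<beta>) \<in> J \<and> (a', \<beta>) \<in> J} \<le> 1" if "a \<noteq> a'" for a a'
      using finR eq[OF _ _ _ _ that] by (auto simp: card_le_Suc0_iff_eq J_def)
    show "card {a\<in>A. (a, \<beta>) \<in> J \<and> (a, \<gamma>) \<in> J} \<le> 1" if "\<beta> \<noteq> \<gamma>" for \<beta> \<gamma>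
      using fin(1) eq[of \<beta> \<gamma>] that by (auto simp: card_le_Suc0_iff_eq J_def)
  qed simp
  moreover have "card (J \<inter> A \<times> ?R) = (\<Sum>\<beta>\<in>?R. card (fst \<beta>))"
  proof -
    \<comment> \<open>Double counting: the edges of the incidence graph, grouped by block.\<close>
    have sub: "fst \<beta> \<subseteq> A" if "\<beta> \<in> ?R" for \<beta>
      using rich_block_subset(1)[OF E, of "fst \<beta>" "snd \<beta>"] that by simp
    then have "J \<inter> A \<times> ?R = prod.swap ` (SIGMA \<beta>:?R. fst \<beta>)"
      by (fastforce simp: J_def)
    then have "card (J \<inter> A \<times> ?R) = card (SIGMA \<beta>:?R. fst \<beta>)"
      by (simp add: card_image)
    also have "\<dots> = (\<Sum>\<beta>\<in>?R. card (fst \<beta>))"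
      using sub fin(1) finite_subset by (intro card_SigmaI[OF finR]) blast
    finally show ?thesis .
  qed
  ultimately show ?thesis by simp
qed

lemma sum_right_sides:
  fixes E :: "('a \<times> 'b) set"
  assumes "finite A" "finite B" "E \<subseteq> A \<times> B" "no_P7 (E\<inverse>)" "no_K33_minus_edge E"
  shows "(\<Sum>\<beta>\<in>rich_blocks E. card (snd \<beta>)) \<le> 2 * (card B + card (rich_blocks E))"
proof -
  have "E\<inverse> \<subseteq> B \<times> A" using assms(3) by auto
  from sum_left_sides[OF assms(2,1) this assms(4)] show ?thesis
    using assms(5)
    by (simp add: no_K33_minus_edge_converse rich_blocks_converse sum.reindex card_image o_def)
qed

text \<open>Each rich block contributes at least \<open>6\<close> to the two sums of sizes, which together are at most
  \<open>2n + 4r\<close> for \<open>r\<close> rich blocks; hence \<open>r \<le> n\<close>. With a threshold of two instead of three the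
  \<open>6\<close> would drop to \<open>4\<close> and nothing would follow.\<close>

lemma card_rich_blocks_le:
  fixes E :: "('a \<times> 'b) set"
  assumes "finite A" "finite B" "E \<subseteq> A \<times> B" "no_P7 E" "no_P7 (E\<inverse>)" "no_K33_minus_edge E"
  shows "card (rich_blocks E) \<le> card A + card B"
proof -
  let ?R = "rich_blocks E"
  have "(\<Sum>\<beta>\<in>?R. 3) \<le> (\<Sum>\<beta>\<in>?R. card (fst \<beta>))" "(\<Sum>\<beta>\<in>?R. 3) \<le> (\<Sum>\<beta>\<in>?R. card (snd \<beta>))"
    by (intro sum_mono; auto simp: rich_blocks_def)+
  then show ?thesis
    using sum_left_sides[of A B E] sum_right_sides[of A B E] assms by simp
qed

section \<open>Edges outside the rich blocks\<close>

definition poor_edges :: "('a \<times> 'b) set \<Rightarrow> ('a \<times> 'b) set" where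
  "poor_edges E = E - (\<Union>(X, Y)\<in>rich_blocks E. X \<times> Y)"

text \<open>A heavy pair is a full side of a block that is too narrow to be rich but may be arbitrarily long
  on the other side. Only such pairs can have many common neighbours outside the rich blocks.\<close>

definition heavy :: "('a \<times> 'b) set \<Rightarrow> 'a \<Rightarrow> 'a \<Rightarrow> bool" where
  "heavy E a a' \<longleftrightarrow> a \<noteq> a' \<and> 3 \<le> card (common E {a, a'}) \<and> block E {a, a'} (common E {a, a'})"

lemma symp_heavy: "symp (heavy E)"
  by (auto simp: symp_def heavy_def insert_commute)

lemma no_heavy_path:
  assumes "no_P7 E" "no_K33_minus_edge E"
  shows "\<forall>a1 a2 a3 a4. distinct [a1, a2, a3, a4] \<and> heavy E a1 a2 \<and> heavy E a2 a3
    \<longrightarrow> \<not> heavy E a3 a4"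
proof (intro allI impI notI, elim conjE)
  fix a1 a2 a3 a4
  assume "distinct [a1, a2, a3, a4]" "heavy E a1 a2" "heavy E a2 a3" "heavy E a3 a4"
  then show False
    using P7_from_blocks[OF assms(2), of "{a1, a2}" _ "{a2, a3}" _ "{a3, a4}" _ a1 a2 a3 a4] assms
    by (auto simp: heavy_def)
qed

text \<open>A graph of minimum degree at least three contains a path on four vertices, so here every
  subgraph has a vertex of degree at most two, and greedy colouring needs three colours.\<close>

lemma three_colouring_if_no_path4:
  assumes "finite A" and "symp H"
    and no: "\<forall>a b c d. distinct [a, b, c, d] \<and> H a b \<and> H b c \<longrightarrow> \<not> H c d"
  shows "\<exists>c :: 'a \<Rightarrow> nat. (\<forall>a. c a < 3) \<and> (\<forall>a\<in>A. \<forall>b\<in>A. a \<noteq> b \<and> H a b \<longrightarrow> c a \<noteq> c b)"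
proof -
  have sym: "H b a" if "H a b" for a b using \<open>symp H\<close> that by (rule sympD)
  have low: "\<exists>a\<in>S. card {b\<in>S - {a}. H a b} \<le> 2" if "finite S" "S \<noteq> {}" for S
  proof (rule ccontr)
    assume "\<not> ?thesis"
    then have deg: "3 \<le> card {b\<in>S - {a}. H a b}" if "a \<in> S" for a using that by fastforce
    have pick: "\<exists>x\<in>S - {a, p, q}. H a x" if "a \<in> S" for a p q
    proof (rule ccontr)
      assume "\<not> ?thesis"
      then have "{b\<in>S - {a}. H a b} \<subseteq> {p, q}" by auto
      then have "card {b\<in>S - {a}. H a b} \<le> card {p, q}" by (intro card_mono) auto
      also have "\<dots> \<le> 2" by (simp add: card_insert_if)
      finally show False using deg[OF that] by simp
    qed
    obtain v2 where v2: "v2 \<in> S" using \<open>S \<noteq> {}\<close> by blast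
    obtain v3 where v3: "v3 \<in> S - {v2}" "H v2 v3" using pick[OF v2] by blast
    obtain v1 where v1: "v1 \<in> S - {v2, v3}" "H v2 v1" using pick[OF v2] by blast
    obtain v4 where v4: "v4 \<in> S - {v3, v1, v2}" "H v3 v4" using pick[of v3 v1 v2] v3 by blast
    show False using no[rule_format, of v1 v2 v3 v4] sym v1 v2 v3 v4 by auto
  qed
  show ?thesis
    using \<open>finite A\<close>
  proof (induction A rule: finite_remove_induct)
    case empty
    show ?case by (intro exI[of _ "\<lambda>_. 0"]) simp
  next
    case (remove S)
    obtain a where a: "a \<in> S" "card {b\<in>S - {a}. H a b} \<le> 2" using low[OF remove.hyps(1,2)] by blast
    obtain c :: "'a \<Rightarrow> nat" where c: "\<forall>a. c a < 3"
      "\<forall>x\<in>S - {a}. \<forall>y\<in>S - {a}. x \<noteq> y \<and> H x y \<longrightarrow> c x \<noteq> c y"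
      using remove.IH[OF a(1)] by blast
    have "card (c ` {b\<in>S - {a}. H a b}) \<le> 2"
      using card_image_le[of "{b\<in>S - {a}. H a b}" c] remove a by simp
    then have "\<not> {..<3} \<subseteq> c ` {b\<in>S - {a}. H a b}"
      using card_mono[of "c ` {b\<in>S - {a}. H a b}" "{..<3}"] remove by auto
    then obtain k where k: "k < 3" "k \<notin> c ` {b\<in>S - {a}. H a b}" by auto
    have new: "k \<noteq> c b" if "b \<in> S" "b \<noteq> a" "H a b" for b using k(2) that by blast
    have "\<forall>x\<in>S. \<forall>y\<in>S. x \<noteq> y \<and> H x y \<longrightarrow> (c(a := k)) x \<noteq> (c(a := k)) y"
    proof (intro ballI impI)
      fix x y assume xy: "x \<in> S" "y \<in> S" "x \<noteq> y \<and> H x y"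
      then consider "x = a" | "y = a" | "x \<in> S - {a}" "y \<in> S - {a}" by blast
      then show "(c(a := k)) x \<noteq> (c(a := k)) y"
      proof cases
        case 1
        then show ?thesis using new[of y] xy by auto
      next
        case 2
        then show ?thesis using new[of x] xy sym[of x y] by auto
      next
        case 3
        then show ?thesis using c(2) xy by auto
      qed
    qed
    moreover have "\<forall>x. (c(a := k)) x < 3" using c(1) k(1) by simp
    ultimately show ?case by blast
  qed
qed

text \<open>If \<open>a\<close> and \<open>a'\<close> have at least three common neighbours, they lie in a block whose right side
  consists of all of these. As the pair is not heavy, this block is rich, and then none
  of the edges from \<open>a\<close> to the common neighbours is poor.\<close>

lemma poor_codegree_le:
  assumes finE: "finite E" and "a \<noteq> a'" "\<not> heavy E a a'"
  shows "card {b\<in>B. (a, b) \<in> poor_edges E \<and> (a', b) \<in> E} \<le> 2"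
proof -
  define C where "C = common E {a, a'}"
  define X where "X = common (E\<inverse>) C"
  have "C \<subseteq> snd ` E" by (force simp: C_def common_def)
  then have "finite C" using finE finite_surj by blast
  have sub: "{b\<in>B. (a, b) \<in> poor_edges E \<and> (a', b) \<in> E} \<subseteq> C"
    by (auto simp: poor_edges_def C_def common_def)
  show ?thesis
  proof (cases "card C \<le> 2")
    case True
    then show ?thesis using card_mono[OF \<open>finite C\<close> sub] by simp
  next
    case False
    have aX: "{a, a'} \<subseteq> X" by (auto simp: X_def C_def common_def)
    have "C \<noteq> {}" using False by auto
    then have "X \<subseteq> fst ` E" by (force simp: X_def common_def)
    then have "finite X" using finE finite_surj by blast
    then have "2 \<le> card X" using card_mono[OF _ aX] \<open>a \<noteq> a'\<close> by simp
    moreover have "common E X = C" using aX by (auto simp: X_def C_def common_def)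
    ultimately have block: "block E X C" using False by (auto simp: block_def X_def)
    then have "X \<noteq> {a, a'}" using assms(2,3) False by (auto simp: heavy_def C_def)
    then have "{a, a'} \<subset> X" using aX by auto
    then have "3 \<le> card X" using psubset_card_mono[OF \<open>finite X\<close>, of "{a, a'}"] \<open>a \<noteq> a'\<close> by simp
    then have "(X, C) \<in> rich_blocks E" using block False by (auto simp: rich_blocks_def)
    then have "(a, b) \<notin> poor_edges E" if "b \<in> C" for b
      using that aX unfolding poor_edges_def by blast
    then have empty: "{b\<in>B. (a, b) \<in> poor_edges E \<and> (a', b) \<in> E} = {}"
      using sub by blast
    show ?thesis unfolding empty by simp
  qed
qed

lemma poor_edges_converse: "poor_edges (E\<inverse>) = (poor_edges E)\<inverse>"
  by (force simp: poor_edges_def rich_blocks_converse)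

text \<open>Colour both sides so that heavy pairs get different colours. Each of the nine pairs of colour
  classes satisfies the sparsity bound with codegree two, and each vertex occurs in three of
  the pairs, whence the constant \<open>12 = 3 * (2 * 2)\<close>.\<close>

lemma card_poor_edges_le:
  fixes E :: "('a \<times> 'b) set"
  assumes fin: "finite A" "finite B" and E: "E \<subseteq> A \<times> B"
    and P7: "no_P7 E" "no_P7 (E\<inverse>)" and K: "no_K33_minus_edge E"
  shows "card (poor_edges E) \<le> 12 * (card A + card B)"
proof -
  have finE: "finite E" using fin E finite_subset by blast
  have K': "no_K33_minus_edge (E\<inverse>)" using K by (simp add: no_K33_minus_edge_converse)
  obtain c :: "'a \<Rightarrow> nat" where c: "\<And>a. c a < 3"
    "\<And>a a'. \<lbrakk>a \<in> A; a' \<in> A; a \<noteq> a'; heavy E a a'\<rbrakk> \<Longrightarrow> c a \<noteq> c a'"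
    using three_colouring_if_no_path4[OF fin(1) symp_heavy no_heavy_path[OF P7(1) K]] by blast
  obtain c' :: "'b \<Rightarrow> nat" where c': "\<And>b. c' b < 3"
    "\<And>b b'. \<lbrakk>b \<in> B; b' \<in> B; b \<noteq> b'; heavy (E\<inverse>) b b'\<rbrakk> \<Longrightarrow> c' b \<noteq> c' b'"
    using three_colouring_if_no_path4[OF fin(2) symp_heavy no_heavy_path[OF P7(2) K']] by blast
  define A' where "A' i = {a\<in>A. c a = i}" for i
  define B' where "B' j = {b\<in>B. c' b = j}" for j
  have finAB: "finite (A' i)" "finite (B' i)" for i using fin by (auto simp: A'_def B'_def)
  have piece: "card (poor_edges E \<inter> A' i \<times> B' j) \<le> 2 * 2 * (card (A' i) + card (B' j))" for i j
  proof (rule card_le_if_small_codegrees[where E = E])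
    show "poor_edges E \<subseteq> E" by (auto simp: poor_edges_def)
    show "card {b\<in>B' j. (a, b) \<in> poor_edges E \<and> (a', b) \<in> E} \<le> 2"
      if "a \<in> A' i" "a' \<in> A' i" "a \<noteq> a'" for a a'
      using poor_codegree_le[OF finE that(3)] c(2)[of a a'] that by (auto simp: A'_def)
    show "card {a\<in>A' i. (a, b) \<in> poor_edges E \<and> (a, b') \<in> E} \<le> 2"
      if "b \<in> B' j" "b' \<in> B' j" "b \<noteq> b'" for b b'
      using poor_codegree_le[of "E\<inverse>" b b' "A' i"] finE c'(2)[of b b'] that
      by (auto simp: B'_def poor_edges_converse)
  qed (use P7 finAB in auto)
  have sumA: "card A = (\<Sum>i<3. card (A' i))"
  proof -
    have "A = (\<Union>i<3. A' i)" using c(1) by (auto simp: A'_def)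
    then show ?thesis
      using card_UN_disjoint[of "{..<3}" A'] finAB by (auto simp: A'_def)
  qed
  have sumB: "card B = (\<Sum>i<3. card (B' i))"
  proof -
    have "B = (\<Union>i<3. B' i)" using c'(1) by (auto simp: B'_def)
    then show ?thesis
      using card_UN_disjoint[of "{..<3}" B'] finAB by (auto simp: B'_def)
  qed
  have pieces: "poor_edges E = (\<Union>i<3. \<Union>j<3. poor_edges E \<inter> A' i \<times> B' j)"
    using E c(1) c'(1) by (auto simp: A'_def B'_def poor_edges_def)
  have "card (poor_edges E) \<le> (\<Sum>i<3. card (\<Union>j<3. poor_edges E \<inter> A' i \<times> B' j))"
    by (subst pieces) (rule card_UN_le, simp)
  also have "\<dots> \<le> (\<Sum>i<3. \<Sum>j<3. card (poor_edges E \<inter> A' i \<times> B' j))"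
    by (intro sum_mono card_UN_le) simp
  also have "\<dots> \<le> (\<Sum>i<3. \<Sum>j<3. 4 * (card (A' i) + card (B' j)))"
    using piece by (intro sum_mono) simp
  also have "\<dots> = 12 * (card A + card B)"
    unfolding sumA sumB by (simp add: numeral_3_eq_3)
  finally show ?thesis .
qed

section \<open>From graphs to bipartite relations\<close>

text \<open>The edges of a bipartite graph oriented from \<open>A\<close> to \<open>B\<close>. Exchanging the parts gives the
  converse relation, so that both kinds of induced \<open>P\<^sub>7\<close> are covered by one lemma.\<close>

definition crossing :: "'a graph \<Rightarrow> 'a set \<Rightarrow> 'a set \<Rightarrow> ('a \<times> 'a) set" where
  "crossing G A B = {(a, b). a \<in> A \<and> b \<in> B \<and> {a, b} \<in> edges G}"

lemma crossing_converse: "(crossing G A B)\<inverse> = crossing G B A"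
  by (auto simp: crossing_def insert_commute)

lemma edges_eq_crossing:
  assumes "simple_graph G" and V: "A \<union> B = verts G"
    and indep: "\<forall>e\<in>edges G. \<not> e \<subseteq> A \<and> \<not> e \<subseteq> B"
  shows "edges G = {{a, b} | a b. (a, b) \<in> crossing G A B}"
proof (intro set_eqI iffI)
  fix e assume e: "e \<in> edges G"
  then have "e \<subseteq> A \<union> B" "card e = 2" using assms by (auto simp: simple_graph_def)
  then obtain u v where uv: "e = {u, v}" by (auto simp: card_2_iff)
  have "\<not> {u, v} \<subseteq> A" "\<not> {u, v} \<subseteq> B" using bspec[OF indep e] uv by auto
  then consider "u \<in> A" "v \<in> B" | "v \<in> A" "u \<in> B" using \<open>e \<subseteq> A \<union> B\<close> uv by auto
  then show "e \<in> {{a, b} | a b. (a, b) \<in> crossing G A B}"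
  proof cases
    case 1
    then have "(u, v) \<in> crossing G A B" using e uv by (simp add: crossing_def)
    then show ?thesis using uv by blast
  next
    case 2
    then have "(v, u) \<in> crossing G A B" using e uv by (simp add: crossing_def insert_commute)
    moreover have "e = {v, u}" using uv by auto
    ultimately show ?thesis by blast
  qed
qed (auto simp: crossing_def)

lemma path_graph_edge_iff:
  "{u, v} \<in> edges (path_graph n) \<longleftrightarrow> (v = Suc u \<and> v < n) \<or> (u = Suc v \<and> u < n)"
  by (auto simp: path_graph_def doubleton_eq_iff)

lemma no_P7_crossing:
  assumes V: "A \<union> B = verts G" and disj: "A \<inter> B = {}"
    and indep: "\<forall>e\<in>edges G. \<not> e \<subseteq> A \<and> \<not> e \<subseteq> B"
    and free: "induced_free (path_graph 7) G"
  shows "no_P7 (crossing G A B)"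
  unfolding no_P7_def
proof (intro notI, elim exE conjE)
  fix a1 a2 a3 a4 b1 b2 b3
  let ?E = "crossing G A B"
  assume ins: "{(a1, b1), (a2, b1), (a2, b2), (a3, b2), (a3, b3), (a4, b3)} \<subseteq> ?E"
    and out: "{(a1, b2), (a1, b3), (a2, b3), (a3, b1), (a4, b1), (a4, b2)} \<inter> ?E = {}"
  define vs where "vs = [a1, b1, a2, b2, a3, b3, a4]"
  have mem: "a1 \<in> A" "a2 \<in> A" "a3 \<in> A" "a4 \<in> A" "b1 \<in> B" "b2 \<in> B" "b3 \<in> B"
    using ins by (auto simp: crossing_def)
  have AA: "{x, y} \<notin> edges G" if "x \<in> A" "y \<in> A" for x y
    using bspec[OF indep, of "{x, y}"] that by auto
  have BB: "{x, y} \<notin> edges G" if "x \<in> B" "y \<in> B" for x y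
    using bspec[OF indep, of "{x, y}"] that by auto
  have loopless: "{x} \<notin> edges G" if "x \<in> A \<or> x \<in> B" for x
    using AA[of x x] BB[of x x] that by auto
  have AB: "{x, y} \<in> edges G \<longleftrightarrow> (x, y) \<in> ?E" "{y, x} \<in> edges G \<longleftrightarrow> (x, y) \<in> ?E"
    if "x \<in> A" "y \<in> B" for x y using that by (auto simp: crossing_def insert_commute)
  have AneB: "x \<noteq> y" "y \<noteq> x" if "x \<in> A" "y \<in> B" for x y using that disj by auto
  have ne: "a1 \<noteq> a2" "a1 \<noteq> a3" "a1 \<noteq> a4" "a2 \<noteq> a3" "a2 \<noteq> a4" "a3 \<noteq> a4"
    "b1 \<noteq> b2" "b1 \<noteq> b3" "b2 \<noteq> b3"
    using ins out by auto
  have "distinct vs" using ne mem AneB by (simp add: vs_def)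
  then have bij: "bij_betw ((!) vs) {..<7} (set vs)"
    by (intro bij_betw_nth) (auto simp: vs_def)
  have less7: "{..<7::nat} = {0, 1, 2, 3, 4, 5, 6}" by auto
  have "\<forall>u\<in>{..<7}. \<forall>v\<in>{..<7}.
      {u, v} \<in> edges (path_graph 7) \<longleftrightarrow> {vs ! u, vs ! v} \<in> edges G"
    unfolding less7 path_graph_edge_iff using ins out mem
    by (simp add: vs_def AA BB AB loopless)
  moreover have "{vs ! u, vs ! v} \<subseteq> set vs" if "u \<in> {..<7}" "v \<in> {..<7}" for u v
    using that by (simp add: vs_def del: list.set)
  ultimately have "isomorphic (path_graph 7) (induced_subgraph G (set vs))"
    using bij unfolding isomorphic_def induced_subgraph_def
    by (intro exI[of _ "(!) vs"]) (simp add: path_graph_def)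
  moreover have "set vs \<subseteq> verts G" using mem V by (auto simp: vs_def)
  ultimately show False using free unfolding induced_free_def by blast
qed

lemma no_K33_minus_edge_crossing:
  assumes V: "A \<union> B = verts G" and disj: "A \<inter> B = {}"
    and indep: "\<forall>e\<in>edges G. \<not> e \<subseteq> A \<and> \<not> e \<subseteq> B"
    and free: "induced_free K33_minus_edge G"
  shows "no_K33_minus_edge (crossing G A B)"
  unfolding no_K33_minus_edge_def
proof (intro allI impI, elim conjE, rule ccontr)
  fix a0 a1 a2 b0 b1 b2
  let ?E = "crossing G A B"
  assume dist: "distinct [a0, a1, a2]" "distinct [b0, b1, b2]"
    and ins: "{(a0, b1), (a0, b2), (a1, b0), (a1, b1), (a1, b2), (a2, b0), (a2, b1), (a2, b2)} \<subseteq> ?E"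
    and out: "(a0, b0) \<notin> ?E"
  define f where "f = case_sum ((!) [a0, a1, a2]) ((!) [b0, b1, b2])"
  define S where "S = {a0, a1, a2} \<union> {b0, b1, b2}"
  have mem: "a0 \<in> A" "a1 \<in> A" "a2 \<in> A" "b0 \<in> B" "b1 \<in> B" "b2 \<in> B"
    using ins by (auto simp: crossing_def)
  have AA: "{x, y} \<notin> edges G" if "x \<in> A" "y \<in> A" for x y
    using bspec[OF indep, of "{x, y}"] that by auto
  have BB: "{x, y} \<notin> edges G" if "x \<in> B" "y \<in> B" for x y
    using bspec[OF indep, of "{x, y}"] that by auto
  have loopless: "{x} \<notin> edges G" if "x \<in> A \<or> x \<in> B" for x
    using AA[of x x] BB[of x x] that by auto
  have AB: "{x, y} \<in> edges G \<longleftrightarrow> (x, y) \<in> ?E" "{y, x} \<in> edges G \<longleftrightarrow> (x, y) \<in> ?E"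
    if "x \<in> A" "y \<in> B" for x y using that by (auto simp: crossing_def insert_commute)
  have AneB: "x \<noteq> y" "y \<noteq> x" if "x \<in> A" "y \<in> B" for x y using that disj by auto
  have verts: "verts K33_minus_edge = {Inl 0, Inl 1, Inl 2, Inr 0, Inr 1, Inr 2}"
  proof -
    have "{..<3::nat} = {0, 1, 2}" by auto
    then show ?thesis
      by (auto simp: K33_minus_edge_def delete_edge_def complete_bipartite_def Plus_def)
  qed
  have edge: "{Inl i, Inr j} \<in> edges K33_minus_edge \<longleftrightarrow> i < 3 \<and> j < 3 \<and> (i \<noteq> 0 \<or> j \<noteq> 0)"
    "{Inr j, Inl i} \<in> edges K33_minus_edge \<longleftrightarrow> i < 3 \<and> j < 3 \<and> (i \<noteq> 0 \<or> j \<noteq> 0)"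
    "{Inl i, Inl i'} \<notin> edges K33_minus_edge" "{Inr j, Inr j'} \<notin> edges K33_minus_edge"
    "{Inl i} \<notin> edges K33_minus_edge" "{Inr j} \<notin> edges K33_minus_edge" for i i' j j'
    by (auto simp: K33_minus_edge_def delete_edge_def complete_bipartite_def doubleton_eq_iff)
  have "inj_on f (verts K33_minus_edge)"
    unfolding verts using dist mem AneB by (simp add: f_def)
  moreover have "f ` verts K33_minus_edge = S"
    unfolding verts by (auto simp: f_def S_def)
  ultimately have bij: "bij_betw f (verts K33_minus_edge) S" by (simp add: bij_betw_def)
  have "\<forall>u\<in>verts K33_minus_edge. \<forall>v\<in>verts K33_minus_edge.
      {u, v} \<in> edges K33_minus_edge \<longleftrightarrow> {f u, f v} \<in> edges G"
    unfolding verts using ins out mem by (simp add: f_def AA BB AB loopless edge)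
  moreover have "f u \<in> S" if "u \<in> verts K33_minus_edge" for u
    using bij that by (auto simp: bij_betw_def)
  ultimately have "isomorphic K33_minus_edge (induced_subgraph G S)"
    using bij unfolding isomorphic_def induced_subgraph_def
    by (intro exI[of _ f]) simp
  moreover have "S \<subseteq> verts G" using mem V by (auto simp: S_def)
  ultimately show False using free unfolding induced_free_def by blast
qed

section \<open>The upper bound\<close>

text \<open>Points above \<open>n\<close> name bicliques: \<open>c > n\<close> joins every \<open>a\<close> with \<open>(a, c) \<in> R\<close> to every \<open>b\<close> with
  \<open>(c, b) \<in> R\<close>. Pairs of points up to \<open>n\<close> are single edges. The orientation of the pairs records the two
  sides of a biclique.\<close>

definition decode :: "nat \<Rightarrow> (nat \<times> nat) set \<Rightarrow> nat graph" where
  "decode n R = \<lparr>verts = {1..n},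
     edges = {{a, b} | a b. a \<le> n \<and> b \<le> n \<and> (a, b) \<in> R} \<union>
             {{a, b} | a b. \<exists>c>n. (a, c) \<in> R \<and> (c, b) \<in> R}\<rparr>"

text \<open>The code consists of the poor edges (at most \<open>12n\<close> pairs) and, for each rich block, the
  memberships of its vertices (at most \<open>6n\<close> pairs in total). As there are at most \<open>n\<close> rich
  blocks, the points \<open>n + 1, \<dots>, 2n\<close> suffice to name them.\<close>

lemma ex_code:
  assumes G: "simple_graph G" "bipartite G" "induced_free (path_graph 7) G"
      "induced_free K33_minus_edge G"
    and V: "verts G = {1..n}"
  shows "\<exists>R \<subseteq> {1..2 * n} \<times> {1..2 * n}. card R \<le> 18 * n \<and> decode n R = G"
proof -
  obtain A B where AB: "A \<union> B = verts G" "A \<inter> B = {}"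
    "\<forall>e\<in>edges G. \<not> e \<subseteq> A \<and> \<not> e \<subseteq> B"
    using G(2) by (auto simp: bipartite_def)
  define E where "E = crossing G A B"
  let ?R = "rich_blocks E"
  have fin: "finite A" "finite B" using AB(1) V by (metis finite_Un finite_atLeastAtMost)+
  have n: "card A + card B = n" using AB(1,2) V fin card_Un_disjoint[of A B] by simp
  have E: "E \<subseteq> A \<times> B" by (auto simp: E_def crossing_def)
  have P7: "no_P7 E" "no_P7 (E\<inverse>)"
    using no_P7_crossing[OF AB G(3)] no_P7_crossing[of B A G] AB G(3)
    by (auto simp: E_def crossing_converse Un_commute Int_commute)
  have K: "no_K33_minus_edge E"
    using no_K33_minus_edge_crossing[OF AB G(4)] by (simp add: E_def)
  have finR: "finite ?R" using finite_rich_blocks[OF fin E] .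
  have cardR: "card ?R \<le> n" using card_rich_blocks_le[OF fin E P7 K] n by simp
  have "card ?R \<le> card {n + 1..2 * n}" using cardR by simp
  then obtain g where g: "inj_on g ?R" "g ` ?R \<subseteq> {n + 1..2 * n}"
    using card_le_inj[OF finR] by blast
  define L where "L = (\<lambda>(\<beta>, a). (a, g \<beta>)) ` (SIGMA \<beta>:?R. fst \<beta>)"
  define M where "M = (\<lambda>(\<beta>, b). (g \<beta>, b)) ` (SIGMA \<beta>:?R. snd \<beta>)"
  define R where "R = poor_edges E \<union> L \<union> M"
  have sides: "fst \<beta> \<subseteq> A" "snd \<beta> \<subseteq> B" if "\<beta> \<in> ?R" for \<beta>
    using rich_block_subset[OF E, of "fst \<beta>" "snd \<beta>"] that by auto
  have finsides: "finite (fst \<beta>)" "finite (snd \<beta>)" if "\<beta> \<in> ?R" for \<beta>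
    using sides[OF that] fin finite_subset by blast+
  have A: "A \<subseteq> {1..n}" and B: "B \<subseteq> {1..n}" using AB(1) V by auto
  have gR: "n < g \<beta>" "g \<beta> \<le> 2 * n" if "\<beta> \<in> ?R" for \<beta> using g(2) that by auto
  have poor: "poor_edges E \<subseteq> A \<times> B" using E by (auto simp: poor_edges_def)
  have L_iff: "(a, c) \<in> L \<longleftrightarrow> (\<exists>\<beta>\<in>?R. a \<in> fst \<beta> \<and> c = g \<beta>)" for a c
    by (force simp: L_def)
  have M_iff: "(c, b) \<in> M \<longleftrightarrow> (\<exists>\<beta>\<in>?R. b \<in> snd \<beta> \<and> c = g \<beta>)" for b c
    by (force simp: M_def)
  have "(a, b) \<in> {1..2 * n} \<times> {1..2 * n}" if ab: "(a, b) \<in> R" for a b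
  proof -
    consider "(a, b) \<in> poor_edges E" | \<beta> where "\<beta> \<in> ?R" "a \<in> fst \<beta>" "b = g \<beta>"
      | \<beta> where "\<beta> \<in> ?R" "b \<in> snd \<beta>" "a = g \<beta>"
      using ab unfolding R_def Un_iff L_iff M_iff by blast
    then show ?thesis
    proof cases
      case 1
      then have "a \<in> {1..n}" "b \<in> {1..n}" using poor A B by auto
      then show ?thesis by simp
    next
      case 2
      then have "a \<in> {1..n}" using sides(1) A by blast
      then show ?thesis using 2 gR[of \<beta>] by simp
    next
      case 3
      then have "b \<in> {1..n}" using sides(2) B by blast
      then show ?thesis using 3 gR[of \<beta>] by simp
    qed
  qed
  then have "R \<subseteq> {1..2 * n} \<times> {1..2 * n}" by (rule subrelI)
  moreover have "card R \<le> 18 * n"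
  proof -
    have "card L \<le> card (SIGMA \<beta>:?R. fst \<beta>)"
      unfolding L_def using finR finsides by (intro card_image_le) auto
    also have "\<dots> = (\<Sum>\<beta>\<in>?R. card (fst \<beta>))" using finR finsides by simp
    finally have L: "card L \<le> 2 * (card A + card ?R)"
      using sum_left_sides[OF fin E P7(1) K] by simp
    have "card M \<le> card (SIGMA \<beta>:?R. snd \<beta>)"
      unfolding M_def using finR finsides by (intro card_image_le) auto
    also have "\<dots> = (\<Sum>\<beta>\<in>?R. card (snd \<beta>))" using finR finsides by simp
    finally have M: "card M \<le> 2 * (card B + card ?R)"
      using sum_right_sides[OF fin E P7(2) K] by simp
    have "card R \<le> card (poor_edges E) + card L + card M"
      unfolding R_def by (meson add_le_mono1 card_Un_le order_trans)
    then show ?thesis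
      using card_poor_edges_le[OF fin E P7 K] L M n cardR by simp
  qed
  moreover have "decode n R = G"
  proof -
    \<comment> \<open>Names of blocks exceed \<open>n\<close>, so they cannot be confused with vertices.\<close>
    have direct: "a \<le> n \<and> b \<le> n \<and> (a, b) \<in> R \<longleftrightarrow> (a, b) \<in> poor_edges E" for a b
      using poor A B gR by (fastforce simp: R_def L_iff M_iff)
    have via: "(\<exists>c>n. (a, c) \<in> R \<and> (c, b) \<in> R) \<longleftrightarrow> (\<exists>\<beta>\<in>?R. a \<in> fst \<beta> \<and> b \<in> snd \<beta>)" for a b
    proof
      assume "\<exists>c>n. (a, c) \<in> R \<and> (c, b) \<in> R"
      then obtain c where c: "n < c" "(a, c) \<in> R" "(c, b) \<in> R" by blast
      have "c \<notin> A" "c \<notin> B" using c(1) A B by auto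
      then have "(a, c) \<notin> poor_edges E" "(a, c) \<notin> M" "(c, b) \<notin> poor_edges E" "(c, b) \<notin> L"
        using poor sides unfolding L_iff M_iff by blast+
      then have "(a, c) \<in> L" "(c, b) \<in> M" using c(2,3) unfolding R_def by blast+
      then show "\<exists>\<beta>\<in>?R. a \<in> fst \<beta> \<and> b \<in> snd \<beta>"
        using g(1) by (auto simp: L_iff M_iff dest: inj_onD)
    next
      assume "\<exists>\<beta>\<in>?R. a \<in> fst \<beta> \<and> b \<in> snd \<beta>"
      then show "\<exists>c>n. (a, c) \<in> R \<and> (c, b) \<in> R"
        using gR by (auto simp: R_def L_iff M_iff)
    qed
    have E_iff: "(a, b) \<in> E \<longleftrightarrow> (a, b) \<in> poor_edges E \<or> (\<exists>\<beta>\<in>?R. a \<in> fst \<beta> \<and> b \<in> snd \<beta>)" for a b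
      by (auto simp: poor_edges_def rich_blocks_def dest: block_edge)
    have "edges (decode n R) = {{a, b} | a b. (a, b) \<in> poor_edges E} \<union>
        {{a, b} | a b. \<exists>\<beta>\<in>?R. a \<in> fst \<beta> \<and> b \<in> snd \<beta>}"
      by (simp add: decode_def direct[simplified] via)
    also have "\<dots> = {{a, b} | a b. (a, b) \<in> E}"
      unfolding E_iff by blast
    also have "\<dots> = edges G" using edges_eq_crossing[OF G(1) AB(1,3)] by (simp add: E_def)
    finally show ?thesis using V by (simp add: decode_def)
  qed
  ultimately show ?thesis by blast
qed

text \<open>A set of at most \<open>m\<close> elements can be listed in \<open>m\<close> slots, where unused slots hold \<^const>\<open>None\<close>.\<close>

lemma card_small_subsets_le:
  assumes "finite U"
  shows "finite {R. R \<subseteq> U \<and> card R \<le> m}" "card {R. R \<subseteq> U \<and> card R \<le> m} \<le> (card U + 1) ^ m"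
proof -
  define W where "W = {xs. set xs \<subseteq> insert None (Some ` U) \<and> length xs = m}"
  have finW: "finite W" unfolding W_def using assms by (intro finite_lists_length_eq) simp
  have "card (insert None (Some ` U)) = card U + 1"
    using assms by (simp add: card_image)
  then have cardW: "card W = (card U + 1) ^ m"
    unfolding W_def using assms by (subst card_lists_length_eq) auto
  have sub: "{R. R \<subseteq> U \<and> card R \<le> m} \<subseteq> (\<lambda>xs. {x. Some x \<in> set xs}) ` W"
  proof clarify
    fix R assume R: "R \<subseteq> U" "card R \<le> m"
    obtain ys where ys: "set ys = R" "length ys = card R"
      using R(1) assms by (metis distinct_card finite_distinct_list finite_subset)
    show "R \<in> (\<lambda>xs. {x. Some x \<in> set xs}) ` W"
    proof (rule image_eqI)
      show "R = {x. Some x \<in> set (map Some ys @ replicate (m - card R) None)}"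
        using ys by auto
      show "map Some ys @ replicate (m - card R) None \<in> W"
        using ys R by (auto simp: W_def)
    qed
  qed
  show "finite {R. R \<subseteq> U \<and> card R \<le> m}" using sub finW finite_surj by blast
  show "card {R. R \<subseteq> U \<and> card R \<le> m} \<le> (card U + 1) ^ m"
    using surj_card_le[OF finW sub] cardW by simp
qed

abbreviation P7_K33e_free_bipartite :: "nat graph set" where
  "P7_K33e_free_bipartite \<equiv> {G. simple_graph G \<and> bipartite G \<and>
     induced_free (path_graph 7) G \<and> induced_free K33_minus_edge G}"

lemma labelled_graphs_upper:
  "finite (labelled_graphs P7_K33e_free_bipartite n)"
  "card (labelled_graphs P7_K33e_free_bipartite n) \<le> (4 * n\<^sup>2 + 1) ^ (18 * n)"
proof -
  let ?U = "{1..2 * n} \<times> {1..2 * n}"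
  have sub: "labelled_graphs P7_K33e_free_bipartite n \<subseteq> decode n ` {R. R \<subseteq> ?U \<and> card R \<le> 18 * n}"
  proof
    fix G assume "G \<in> labelled_graphs P7_K33e_free_bipartite n"
    then show "G \<in> decode n ` {R. R \<subseteq> ?U \<and> card R \<le> 18 * n}"
      using ex_code[of G n] by (auto simp: labelled_graphs_def)
  qed
  have fin: "finite {R. R \<subseteq> ?U \<and> card R \<le> 18 * n}" by (rule card_small_subsets_le) simp
  show "finite (labelled_graphs P7_K33e_free_bipartite n)" using sub fin finite_surj by blast
  have "card (labelled_graphs P7_K33e_free_bipartite n) \<le> card {R. R \<subseteq> ?U \<and> card R \<le> 18 * n}"
    using surj_card_le[OF fin sub] .
  also have "\<dots> \<le> (card ?U + 1) ^ (18 * n)" by (rule card_small_subsets_le) simp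
  also have "card ?U = 4 * n\<^sup>2" by (simp add: card_cartesian_product power2_eq_square)
  finally show "card (labelled_graphs P7_K33e_free_bipartite n) \<le> (4 * n\<^sup>2 + 1) ^ (18 * n)" .
qed

section \<open>The lower bound\<close>

text \<open>The vertices \<open>1, \<dots>, k\<close> are centres, and each later vertex is attached to the centre \<open>f i\<close>.\<close>

definition star_forest :: "nat \<Rightarrow> nat \<Rightarrow> (nat \<Rightarrow> nat) \<Rightarrow> nat graph" where
  "star_forest n k f = \<lparr>verts = {1..n}, edges = {{i, f i} | i. i \<in> {k + 1..n}}\<rparr>"

text \<open>In a star forest every edge has an end of degree one. The middle edge of the walk
  \<open>s, t, u, v\<close> has no such end.\<close>

lemma star_forest_free:
  assumes f: "f \<in> {k + 1..n} \<rightarrow> {1..k}"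
    and H: "{s, t, u, v} \<subseteq> verts H" "s \<noteq> u" "t \<noteq> v" "{s, t} \<in> edges H" "{t, u} \<in> edges H" "{u, v} \<in> edges H"
  shows "induced_free H (star_forest n k f)"
  unfolding induced_free_def
proof (intro notI, elim exE conjE)
  fix S assume "isomorphic H (induced_subgraph (star_forest n k f) S)"
  then obtain h where inj: "inj_on h (verts H)"
    and h: "\<And>x y. \<lbrakk>x \<in> verts H; y \<in> verts H; {x, y} \<in> edges H\<rbrakk> \<Longrightarrow> {h x, h y} \<in> edges (star_forest n k f)"
    by (auto simp: isomorphic_def induced_subgraph_def bij_betw_def)
  have ne: "h s \<noteq> h u" "h t \<noteq> h v" using inj H by (auto dest: inj_onD)
  have edge: "(k < x \<and> y = f x \<and> y \<le> k) \<or> (k < y \<and> x = f y \<and> x \<le> k)"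
    if "{x, y} \<in> edges (star_forest n k f)" for x y
    using that f by (fastforce simp: star_forest_def doubleton_eq_iff Pi_iff)
  show False
    using edge[OF h[of s t]] edge[OF h[of t u]] edge[OF h[of u v]] H ne by auto
qed

lemma star_forest_in_class:
  assumes f: "f \<in> {k + 1..n} \<rightarrow> {1..k}" and "k \<le> n"
  shows "star_forest n k f \<in> labelled_graphs P7_K33e_free_bipartite n"
proof -
  have f': "1 \<le> f i" "f i \<le> k" if "k < i" "i \<le> n" for i using f that by (auto simp: Pi_iff)
  have "simple_graph (star_forest n k f)"
    unfolding simple_graph_def
  proof (intro conjI ballI)
    fix e assume "e \<in> edges (star_forest n k f)"
    then obtain i where i: "e = {i, f i}" "k < i" "i \<le> n" by (auto simp: star_forest_def)
    then show "e \<subseteq> verts (star_forest n k f)" "card e = 2"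
      using f'[of i] by (auto simp: star_forest_def)
  qed (simp add: star_forest_def)
  moreover have "bipartite (star_forest n k f)"
    unfolding bipartite_def
  proof (intro exI conjI)
    show "{1..k} \<union> {k + 1..n} = verts (star_forest n k f)"
      using \<open>k \<le> n\<close> by (auto simp: star_forest_def)
    show "\<forall>e\<in>edges (star_forest n k f). \<not> e \<subseteq> {1..k} \<and> \<not> e \<subseteq> {k + 1..n}"
    proof
      fix e assume "e \<in> edges (star_forest n k f)"
      then obtain i where "e = {i, f i}" "k < i" "i \<le> n" by (auto simp: star_forest_def)
      then show "\<not> e \<subseteq> {1..k} \<and> \<not> e \<subseteq> {k + 1..n}" using f'[of i] by auto
    qed
  qed auto
  moreover have "induced_free (path_graph 7) (star_forest n k f)"
    by (rule star_forest_free[OF f, of 0 1 2 3]) (auto simp: path_graph_edge_iff, auto simp: path_graph_def)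
  moreover have "induced_free K33_minus_edge (star_forest n k f)"
    by (rule star_forest_free[OF f, of "Inl 1" "Inr 1" "Inl 2" "Inr 2"])
       (auto simp: K33_minus_edge_def delete_edge_def complete_bipartite_def doubleton_eq_iff)
  ultimately show ?thesis by (simp add: labelled_graphs_def star_forest_def)
qed

text \<open>The map \<open>f\<close> can be read off from its star forest, since of the two ends of an edge only the
  leaf exceeds \<open>k\<close>.\<close>

lemma labelled_graphs_lower:
  assumes "k \<le> n"
  shows "k ^ (n - k) \<le> card (labelled_graphs P7_K33e_free_bipartite n)"
proof -
  let ?F = "{k + 1..n} \<rightarrow>\<^sub>E {1..k}"
  have "inj_on (star_forest n k) ?F"
  proof (rule inj_onI)
    fix f g assume f: "f \<in> ?F" and g: "g \<in> ?F" and eq: "star_forest n k f = star_forest n k g"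
    have "f i = g i" if i: "i \<in> {k + 1..n}" for i
    proof -
      have "{i, f i} \<in> edges (star_forest n k g)"
        unfolding eq[symmetric] using i by (auto simp: star_forest_def)
      then obtain j where j: "j \<in> {k + 1..n}" "{i, f i} = {j, g j}" by (auto simp: star_forest_def)
      have "f i \<le> k" "g j \<le> k" using f g i j(1) by (fastforce simp: PiE_iff)+
      then show ?thesis using i j by (auto simp: doubleton_eq_iff)
    qed
    then show "f = g" using f g by (intro PiE_ext) auto
  qed
  then have "card ?F = card (star_forest n k ` ?F)" by (simp add: card_image)
  also have "\<dots> \<le> card (labelled_graphs P7_K33e_free_bipartite n)"
    using star_forest_in_class[OF _ assms]
    by (intro card_mono labelled_graphs_upper) (auto simp: PiE_iff)
  finally show ?thesis by (simp add: card_PiE)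
qed

section \<open>The class is hereditary\<close>

lemma induced_subgraph_induced_subgraph:
  "T \<subseteq> S \<Longrightarrow> induced_subgraph (induced_subgraph G S) T = induced_subgraph G T"
  by (auto simp: induced_subgraph_def)

lemma induced_free_induced_subgraph:
  assumes "induced_free H G" "S \<subseteq> verts G"
  shows "induced_free H (induced_subgraph G S)"
proof -
  have "verts (induced_subgraph G S) = S" by (simp add: induced_subgraph_def)
  then show ?thesis
    using assms induced_subgraph_induced_subgraph unfolding induced_free_def
    by (metis order_trans)
qed

lemma induced_free_isomorphic:
  assumes "isomorphic G G'" "induced_free H G"
  shows "induced_free H G'"
  unfolding induced_free_def
proof (intro notI, elim exE conjE)
  fix T assume T: "T \<subseteq> verts G'" "isomorphic H (induced_subgraph G' T)"
  obtain f where f: "bij_betw f (verts G) (verts G')"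
    "\<And>u v. \<lbrakk>u \<in> verts G; v \<in> verts G\<rbrakk> \<Longrightarrow> {u, v} \<in> edges G \<longleftrightarrow> {f u, f v} \<in> edges G'"
    using assms(1) by (auto simp: isomorphic_def)
  obtain g where g: "bij_betw g (verts H) T"
    "\<And>u v. \<lbrakk>u \<in> verts H; v \<in> verts H\<rbrakk> \<Longrightarrow>
      {u, v} \<in> edges H \<longleftrightarrow> {g u, g v} \<in> edges G' \<and> {g u, g v} \<subseteq> T"
    using T(2) unfolding isomorphic_def by (auto simp: induced_subgraph_def)
  define f' where "f' = inv_into (verts G) f"
  have f': "bij_betw f' (verts G') (verts G)" using f(1) by (simp add: f'_def bij_betw_inv_into)
  have ff': "f (f' x) = x" if "x \<in> verts G'" for x
    using f(1) that by (simp add: f'_def bij_betw_inv_into_right)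
  have "bij_betw f' T (f' ` T)" using f' T(1) bij_betw_subset by blast
  with g(1) have bij: "bij_betw (f' \<circ> g) (verts H) (f' ` T)" by (rule bij_betw_trans)
  have gT: "g u \<in> T" if "u \<in> verts H" for u using g(1) that by (auto simp: bij_betw_def)
  have sub: "f' ` T \<subseteq> verts G" using f' T(1) by (auto simp: bij_betw_def)
  have "{u, v} \<in> edges H \<longleftrightarrow> {f' (g u), f' (g v)} \<in> edges G \<and> {f' (g u), f' (g v)} \<subseteq> f' ` T"
    if "u \<in> verts H" "v \<in> verts H" for u v
  proof -
    have "g u \<in> verts G'" "g v \<in> verts G'" using gT that T(1) by auto
    moreover have "f' (g u) \<in> verts G" "f' (g v) \<in> verts G" using gT that sub by auto
    ultimately show ?thesis
      using g(2)[OF that] f(2)[of "f' (g u)" "f' (g v)"] gT that by (simp add: ff')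
  qed
  then have "isomorphic H (induced_subgraph G (f' ` T))"
    unfolding isomorphic_def using bij
    by (intro exI[of _ "f' \<circ> g"]) (simp add: induced_subgraph_def)
  with assms(2) sub show False unfolding induced_free_def by blast
qed

lemma bipartite_isomorphic:
  assumes "isomorphic G G'" "simple_graph G'" "bipartite G"
  shows "bipartite G'"
proof -
  obtain f where f: "bij_betw f (verts G) (verts G')"
    "\<And>u v. \<lbrakk>u \<in> verts G; v \<in> verts G\<rbrakk> \<Longrightarrow> {u, v} \<in> edges G \<longleftrightarrow> {f u, f v} \<in> edges G'"
    using assms(1) by (auto simp: isomorphic_def)
  obtain A B where AB: "A \<union> B = verts G" "A \<inter> B = {}"
    "\<forall>e\<in>edges G. \<not> e \<subseteq> A \<and> \<not> e \<subseteq> B"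
    using assms(3) by (auto simp: bipartite_def)
  have indep: "\<not> e \<subseteq> f ` C" if e: "e \<in> edges G'" and C: "C \<subseteq> verts G" "\<forall>e\<in>edges G. \<not> e \<subseteq> C" for e C
  proof
    assume sub: "e \<subseteq> f ` C"
    obtain x y where "e = {x, y}" using e assms(2) by (auto simp: simple_graph_def card_2_iff)
    then obtain u v where uv: "u \<in> C" "v \<in> C" "e = {f u, f v}" using sub by auto
    then have "{u, v} \<in> edges G" using f(2)[of u v] e C(1) by auto
    then show False using C(2) uv by auto
  qed
  have "f ` A \<union> f ` B = verts G'" using f(1) AB(1) by (metis bij_betw_imp_surj_on image_Un)
  moreover have "f ` A \<inter> f ` B = {}"
    using f(1) AB(1,2) inj_on_image_Int[of f "verts G" A B] by (auto simp: bij_betw_def)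
  moreover have "\<forall>e\<in>edges G'. \<not> e \<subseteq> f ` A \<and> \<not> e \<subseteq> f ` B"
    using indep[of _ A] indep[of _ B] AB by blast
  ultimately show ?thesis unfolding bipartite_def by blast
qed

lemma hereditary_class: "hereditary P7_K33e_free_bipartite"
  unfolding hereditary_def graph_class_def
proof (intro conjI ballI allI impI)
  fix G G' :: "nat graph"
  assume "G \<in> P7_K33e_free_bipartite" "simple_graph G' \<and> isomorphic G G'"
  then show "G' \<in> P7_K33e_free_bipartite"
    using bipartite_isomorphic[of G G'] induced_free_isomorphic[of G G' "path_graph 7"]
      induced_free_isomorphic[of G G' K33_minus_edge] by simp
next
  fix G :: "nat graph" and S
  assume G: "G \<in> P7_K33e_free_bipartite" and S: "S \<subseteq> verts G"
  have "simple_graph (induced_subgraph G S)"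
    using G S by (auto simp: simple_graph_def induced_subgraph_def dest: finite_subset)
  moreover have "bipartite (induced_subgraph G S)"
  proof -
    obtain A B where AB: "A \<union> B = verts G" "A \<inter> B = {}"
      "\<forall>e\<in>edges G. \<not> e \<subseteq> A \<and> \<not> e \<subseteq> B"
      using G unfolding bipartite_def by blast
    show ?thesis unfolding bipartite_def
      by (rule exI[of _ "A \<inter> S"], rule exI[of _ "B \<inter> S"])
         (simp add: induced_subgraph_def, use AB S in blast)
  qed
  ultimately show "induced_subgraph G S \<in> P7_K33e_free_bipartite"
    using G induced_free_induced_subgraph[OF _ S, of "path_graph 7"]
      induced_free_induced_subgraph[OF _ S, of K33_minus_edge] by simp
qed auto

section \<open>The speed of the class\<close>

text \<open>With \<open>k = n div 2\<close> the lower bound is \<open>k\<^bsup>n - k\<^esup> \<ge> (\<surd>n)\<^bsup>n/2\<^esup>\<close> because \<open>n \<le> k\<^sup>2\<close> for \<open>n \<ge> 6\<close>. The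
  upper bound is at most \<open>n\<^bsup>5 * 18n\<^esup>\<close> because \<open>4n\<^sup>2 + 1 \<le> n\<^sup>5\<close>. Hence the constants \<open>1 / 4\<close> and
  \<open>90\<close>.\<close>

theorem theorem16:
  "factorial_class
     {G :: nat graph. simple_graph G \<and> bipartite G \<and>
        induced_free (path_graph 7) G \<and> induced_free K33_minus_edge G}"
proof -
  define c where "c n = card (labelled_graphs P7_K33e_free_bipartite n)" for n
  define f where "f n = log 2 (real (c n))" for n
  have pos: "0 < c n" for n
    using labelled_graphs_lower[of n n] by (simp add: c_def)
  have "real (c n) = 2 powr f n" for n
    using pos[of n] by (simp add: f_def)
  moreover have "f \<in> \<Theta>(\<lambda>n. real n * log 2 (real n))"
  proof (rule bigthetaI'[of "1 / 4" 90])
    show "\<forall>\<^sub>F n in sequentially. 1 / 4 * norm (real n * log 2 (real n)) \<le> norm (f n) \<and>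
        norm (f n) \<le> 90 * norm (real n * log 2 (real n))"
      using eventually_ge_at_top[of 6]
    proof eventually_elim
      case (elim n)
      have logn: "0 \<le> log 2 (real n)" using elim by simp
      have fn: "0 \<le> f n" using pos[of n] by (simp add: f_def)
      define k where "k = n div 2"
      have k: "0 < k" "k \<le> n" "real n / 2 \<le> real (n - k)" using elim by (auto simp: k_def)
      have "n \<le> k\<^sup>2"
      proof -
        have "3 \<le> k" "n \<le> 2 * k + 1" using elim by (auto simp: k_def)
        moreover have "3 * k \<le> k * k" using \<open>3 \<le> k\<close> by (rule mult_le_mono1)
        ultimately show ?thesis unfolding power2_eq_square by linarith
      qed
      then have "log 2 (real n) \<le> log 2 (real k ^ 2)"
        using elim k by (intro log_mono) (auto simp flip: of_nat_power)
      then have "log 2 (real n) / 2 \<le> log 2 (real k)" using k by (simp add: log_nat_power)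
      then have "real n / 2 * (log 2 (real n) / 2) \<le> real (n - k) * log 2 (real k)"
        using k logn by (intro mult_mono) auto
      also have "\<dots> = log 2 (real (k ^ (n - k)))" using k by (simp add: log_nat_power)
      also have "\<dots> \<le> f n"
        unfolding f_def using k pos[of n] labelled_graphs_lower[OF k(2)]
        by (intro log_mono) (auto simp: c_def simp flip: of_nat_power)
      finally have lower: "1 / 4 * (real n * log 2 (real n)) \<le> f n" by simp
      have "4 * n\<^sup>2 + 1 \<le> n ^ 5"
      proof -
        have "5 \<le> n ^ 3" using power_mono[of 6 n 3] elim by simp
        then have "5 * n\<^sup>2 \<le> n ^ 3 * n\<^sup>2" by (rule mult_le_mono1)
        moreover have "1 \<le> n\<^sup>2" using elim by simp
        moreover have "n ^ 3 * n\<^sup>2 = n ^ 5" by (simp flip: power_add)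
        ultimately show ?thesis by linarith
      qed
      then have "(4 * n\<^sup>2 + 1) ^ (18 * n) \<le> (n ^ 5) ^ (18 * n)" by (rule power_mono) simp
      also have "\<dots> = n ^ (90 * n)" by (simp flip: power_mult)
      finally have "c n \<le> n ^ (90 * n)" using labelled_graphs_upper(2)[of n] by (simp add: c_def)
      then have "f n \<le> log 2 (real (n ^ (90 * n)))"
        unfolding f_def using pos[of n] elim by (intro log_mono) (auto simp flip: of_nat_power)
      also have "\<dots> = 90 * (real n * log 2 (real n))" using elim by (simp add: log_nat_power)
      finally show ?case using lower fn logn by simp
    qed
  qed simp_all
  ultimately show ?thesis
    unfolding factorial_class_def using hereditary_class by (auto simp: c_def)
qed

end
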